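(* Let $d\ge 2$ be an integer, let $\delta_0 > 1-\sqrt{(d-1)/d}$, and let $M$ be any mode-resolved photon detection on $d$ optical modes realised with inefficient detectors (outcomes $1,\dots,d$ and "no-click"; see context). Then no $\delta_0$-continuous $\psi$-epistemic model with no-click events can reproduce all the measurement statistics on coherent states of $d$ modes. That is, there is no $\psi$-epistemic ontic model that is $\delta_0$-continuous (with respect to $M$) and that satisfies $P(r|M,Q)=\langle\psi_Q|\mathcal M_r|\psi_Q\rangle$ for every outcome $r\in\{1,\dots,d,\text{no-click}\}$ and every preparation $Q$ whose associated quantum state $|\psi_Q\rangle$ is a $d$-mode coherent state. Here $\mathcal M_r$ is the quantum operator of outcome $r$ of $M$.
   Context: **Hilbert space and coherent states.** The Hilbert space is the bosonic Fock space of $d$ modes, with creation operators $a_1^\dagger,\dots,a_d^\dagger$, vacuum $|0\rangle$, and orthonormal number basis $|n_1,\dots,n_d\rangle$, $n_j\in\{0,1,2,\dots\}$. A $d$-mode coherent state with amplitudes $(\beta_1,\dots,\beta_d)\in\mathbb C^d$ is $e^{-\frac12\sum_j|\beta_j|^2}\exp\big(\sum_j\beta_j a_j^\dagger\big)|0\rangle$. **Inefficient detectors.** An inefficient detector gives a response that depends only on the photon number. If there is no photon it does not click, and if there are one or more photons the probability of clicking is strictly positive. The mode-resolved detection $M$ has outcomes $r\in\{1,\dots,d\}$ (a click registered in mode $r$) and $r=\text{no-click}$. Its operators are diagonal in the number basis, $\mathcal M_r=\sum_{n}p(r|n)\,|n\rangle\langle n|$ with $n=(n_1,\dots,n_d)$.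 For each $n$, $p(\cdot|n)$ is a probability distribution on the $d+1$ outcomes. It satisfies $p(k|n)=0$ whenever $n_k=0$ (for $k=1,\dots,d$), and $\sum_{k=1}^d p(k|n)>0$ whenever $n\neq(0,\dots,0)$. The event "clk" is that the outcome lies in $\{1,\dots,d\}$. **Ontic models.** An ontic model consists of the following data. - A (discrete) set $\Lambda$ of ontic states $\lambda$. - A collection of preparations $Q$, each associated with a pure quantum state (unit vector) $|\psi_Q\rangle$ of the Fock space, such that every $d$-mode coherent state is the state of at least one preparation. - For each preparation $Q$, a probability distribution $P(\lambda|Q)$ on $\Lambda$. - For each $\lambda$, a probability distribution $P(r|M,\lambda)$ over the outcomes $r$ of $M$. The model predicts $P(r|M,Q)=\sum_\lambda P(r|M,\lambda)P(\lambda|Q)$. Write $P(\mathrm{clk}|\lambda)=\sum_{k=1}^d P(k|M,\lambda)$ and $P(\mathrm{clk}|Q)=\sum_\lambda P(\mathrm{clk}|\lambda)P(\lambda|Q)$. When $P(\mathrm{clk}|Q)>0$, set $P(\lambda|Q,\mathrm{clk})=P(\mathrm{clk}|\lambda)P(\lambda|Q)/P(\mathrm{clk}|Q)$ (Bayes' rule). The model is $\psi$-epistemic if there exist preparations $Q,Q'$ corresponding to distinct pure quantum states $|\psi_Q\rangle\neq|\psi_{Q'}\rangle$ and some $\lambda$ such that both $P(\lambda|Q)>0$ and $P(\lambda|Q')>0$. **$\delta_0$-continuity.** For a state $|\psi\rangle$ that is not proportional to the vacuum, let $$|\tilde\psi\rangle=\frac{(I-|0\rangle\langle0|)|\psi\rangle}{\big\|(I-|0\rangle\langle0|)|\psi\rangle\big\|}.$$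 The model (with no-click events) is $\delta_0$-continuous if the following holds. For every preparation $Q$ whose state is not the vacuum and which satisfies $P(\mathrm{clk}|Q)>0$, there exists an ontic state $\lambda$ (which may depend on $Q$) such that $P(\lambda|Q',\mathrm{clk})>0$ for every preparation $Q'$ whose state is not the vacuum and satisfies $|\langle\tilde\psi_{Q'}|\tilde\psi_Q\rangle|\ge 1-\delta_0$. The condition $P(\lambda|Q',\mathrm{clk})>0$ is understood to include $P(\mathrm{clk}|Q')>0$. *)

theory Defs
  imports "HOL-Probability.Probability"
begin

text \<open>
  The Fock space of finitely many modes, indexed by a finite type \<open>'d\<close>, is realised as the space
  of square-summable coefficient families in the number basis: \<open>\<psi> n\<close> is the coefficient of
  \<open>|n\<rangle>\<close>, where \<open>n j\<close> is the number of photons in mode \<open>j\<close>.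
\<close>

type_synonym 'd fock = "('d \<Rightarrow> nat) \<Rightarrow> complex"

definition fock_space :: "'d fock set" where
  "fock_space = {\<psi>. (\<lambda>n. (cmod (\<psi> n))\<^sup>2) summable_on UNIV}"

text \<open>Conjugate-linear in the first argument.\<close>

definition fock_inner :: "'d fock \<Rightarrow> 'd fock \<Rightarrow> complex" where
  "fock_inner \<phi> \<psi> = (\<Sum>\<^sub>\<infinity>n. cnj (\<phi> n) * \<psi> n)"

definition fock_norm :: "'d fock \<Rightarrow> real" where
  "fock_norm \<psi> = sqrt (\<Sum>\<^sub>\<infinity>n. (cmod (\<psi> n))\<^sup>2)"

definition unit_vector :: "'d fock \<Rightarrow> bool" where
  "unit_vector \<psi> \<longleftrightarrow> \<psi> \<in> fock_space \<and> fock_norm \<psi> = 1"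

definition vacuum :: "'d fock" where
  "vacuum n = (if n = (\<lambda>_. 0) then 1 else 0)"

text \<open>
  The creation operator maps \<open>|n\<rangle>\<close> to \<open>sqrt (n j + 1)\<close> times the basis vector with one more
  photon in mode \<open>j\<close>. In coefficients this reads as follows; for \<open>n j = 0\<close> the factor
  \<open>sqrt (n j)\<close> vanishes, so the truncated subtraction is harmless.
\<close>

definition creation :: "'d \<Rightarrow> 'd fock \<Rightarrow> 'd fock" where
  "creation j \<psi> n = complex_of_real (sqrt (real (n j))) * \<psi> (n(j := n j - 1))"

definition creation_sum :: "('d::finite \<Rightarrow> complex) \<Rightarrow> 'd fock \<Rightarrow> 'd fock" where
  "creation_sum \<beta> \<psi> n = (\<Sum>j\<in>UNIV. \<beta> j * creation j \<psi> n)"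

text \<open>
  The exponential of \<open>creation_sum \<beta>\<close> applied to the vacuum is its power series, summed
  coefficientwise: only the term \<open>k = (\<Sum>j\<in>UNIV. n j)\<close> contributes to the coefficient at \<open>n\<close>.
\<close>

definition coherent_state :: "('d::finite \<Rightarrow> complex) \<Rightarrow> 'd fock" where
  "coherent_state \<beta> n =
     complex_of_real (exp (- (1/2) * (\<Sum>j\<in>UNIV. (cmod (\<beta> j))\<^sup>2))) *
     (\<Sum>k. (creation_sum \<beta> ^^ k) vacuum n / fact k)"

lemma creation_sum_power:
  "(creation_sum \<beta> ^^ k) vacuum n =
     (if (\<Sum>j\<in>UNIV. n j) = k
      then fact k * (\<Prod>j\<in>UNIV. \<beta> j ^ n j / complex_of_real (sqrt (fact (n j)))) else 0)"
proof (induction k arbitrary: n)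
  case 0
  show ?case by (auto simp: vacuum_def fun_eq_iff)
next
  case (Suc k)
  let ?F = "\<lambda>n. \<Prod>j\<in>UNIV. \<beta> j ^ n j / complex_of_real (sqrt (fact (n j)))"
  have step: "\<beta> j * creation j ((creation_sum \<beta> ^^ k) vacuum) n =
      (if (\<Sum>j\<in>UNIV. n j) = Suc k then of_nat (n j) * (fact k * ?F n) else 0)" for j
  proof (cases "n j")
    case 0
    then show ?thesis by (simp add: creation_def)
  next
    case (Suc i)
    let ?n = "n(j := i)"
    have s: "(\<Sum>j\<in>UNIV. n j) = Suc (\<Sum>j\<in>UNIV. ?n j)"
      using Suc by (simp add: sum.remove[of UNIV j])
    have pr: "?F n * of_nat (Suc i) = complex_of_real (sqrt (Suc i)) * \<beta> j * ?F ?n"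
    proof -
      define R where "R = (\<Prod>x\<in>UNIV - {j}. \<beta> x ^ n x / complex_of_real (sqrt (fact (n x))))"
      have r: "(\<Prod>x\<in>UNIV - {j}. \<beta> x ^ ?n x / complex_of_real (sqrt (fact (?n x)))) = R"
        unfolding R_def by (intro prod.cong) auto
      have F: "?F n = \<beta> j ^ Suc i / complex_of_real (sqrt (fact (Suc i))) * R"
        by (subst prod.remove[of UNIV j]) (simp_all add: Suc R_def)
      have Fn: "?F ?n = \<beta> j ^ i / complex_of_real (sqrt (fact i)) * R"
        by (subst prod.remove[of UNIV j]) (simp_all add: r del: fun_upd_apply, simp)
      have sf: "complex_of_real (sqrt (fact (Suc i))) =
          complex_of_real (sqrt (Suc i)) * complex_of_real (sqrt (fact i))"
        by (simp add: real_sqrt_mult)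
      have sq: "of_nat (Suc i) = complex_of_real (sqrt (Suc i)) * complex_of_real (sqrt (Suc i))"
        by (simp flip: of_real_mult)
      have nz: "complex_of_real (sqrt (Suc i)) \<noteq> 0" by simp
      show ?thesis
        unfolding F Fn sf sq using nz by simp
    qed
    show ?thesis
    proof (cases "(\<Sum>j\<in>UNIV. ?n j) = k")
      case True
      then have "\<beta> j * creation j ((creation_sum \<beta> ^^ k) vacuum) n =
          fact k * (complex_of_real (sqrt (Suc i)) * \<beta> j * ?F ?n)"
        unfolding creation_def Suc diff_Suc_1 Suc.IH by simp
      also have "\<dots> = of_nat (n j) * (fact k * ?F n)"
        unfolding pr[symmetric] Suc by simp
      finally show ?thesis using True s by simp
    next
      case False
      then show ?thesis
        unfolding creation_def Suc diff_Suc_1 Suc.IH using s by simp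
    qed
  qed
  have "(creation_sum \<beta> ^^ Suc k) vacuum n =
      (\<Sum>j\<in>UNIV. if (\<Sum>j\<in>UNIV. n j) = Suc k then of_nat (n j) * (fact k * ?F n) else 0)"
    by (simp add: creation_sum_def step)
  also have "\<dots> = (if (\<Sum>j\<in>UNIV. n j) = Suc k then of_nat (\<Sum>j\<in>UNIV. n j) * (fact k * ?F n) else 0)"
    unfolding of_nat_sum sum_distrib_right by simp
  finally show ?case by (auto simp: algebra_simps)
qed

lemma coherent_state_coefficient:
  "coherent_state \<beta> n =
     complex_of_real (exp (- (1/2) * (\<Sum>j\<in>UNIV. (cmod (\<beta> j))\<^sup>2))) *
     (\<Prod>j\<in>UNIV. \<beta> j ^ n j / complex_of_real (sqrt (fact (n j))))"
proof -
  have "(\<lambda>k. (creation_sum \<beta> ^^ k) vacuum n / fact k) sums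
     (\<Prod>j\<in>UNIV. \<beta> j ^ n j / complex_of_real (sqrt (fact (n j))))"
    using sums_single[of "\<Sum>j\<in>UNIV. n j" "\<lambda>k. (\<Prod>j\<in>UNIV. \<beta> j ^ n j / complex_of_real (sqrt (fact (n j))))"]
    by (rule sums_cong[THEN iffD1, rotated]) (simp add: creation_sum_power)
  then show ?thesis by (simp add: coherent_state_def sums_unique[symmetric])
qed

lemma unit_vector_coherent_state: "unit_vector (coherent_state \<beta>)"
proof -
  let ?f = "\<lambda>j i. (cmod (\<beta> j))\<^sup>2 ^ i / fact i"
  have su: "(?f j has_sum exp ((cmod (\<beta> j))\<^sup>2)) UNIV" for j
  proof -
    have "?f j sums exp ((cmod (\<beta> j))\<^sup>2)"
      using exp_converges[of "(cmod (\<beta> j))\<^sup>2"] by (simp add: divide_inverse mult.commute)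
    then show ?thesis
      by (subst sums_nonneg_imp_has_sum_strong) auto
  qed
  have c: "(cmod (coherent_state \<beta> n))\<^sup>2 = exp (- (\<Sum>j\<in>UNIV. (cmod (\<beta> j))\<^sup>2)) * (\<Prod>j\<in>UNIV. ?f j (n j))" for n
  proof -
    have e: "(exp (- (1/2) * s))\<^sup>2 = exp (- s)" for s :: real
      by (simp add: power2_eq_square flip: exp_add)
    show ?thesis
      unfolding coherent_state_coefficient
      by (simp only: norm_mult power_mult_distrib e norm_of_real power2_abs
          flip: prod_norm prod_power_distrib)
        (simp add: norm_divide norm_power power_divide prod_power_distrib power_mult[symmetric] mult.commute)
  qed
  have P: "Pi\<^sub>E UNIV (\<lambda>_::'a. UNIV::nat set) = UNIV" by auto
  have b: "infsum (\<lambda>n. \<Prod>j\<in>UNIV. ?f j (n j)) (Pi\<^sub>E UNIV (\<lambda>_. UNIV)) = (\<Prod>j\<in>UNIV. infsum (?f j) UNIV)"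
    using su by (intro infsum_prod_PiE_abs) (auto simp: summable_on_def)
  have b': "(\<Prod>j\<in>UNIV. infsum (?f j) UNIV) = exp (\<Sum>j\<in>UNIV. (cmod (\<beta> j))\<^sup>2)"
    by (simp add: infsumI[OF su] exp_sum)
  have a: "(\<lambda>n. \<Prod>j\<in>UNIV. ?f j (n j)) summable_on UNIV"
  proof (rule ccontr)
    assume "\<not> ?thesis"
    from infsum_not_exists[OF this] b show False unfolding P b' by simp
  qed
  let ?s = "\<Sum>j\<in>UNIV. (cmod (\<beta> j))\<^sup>2"
  have h: "((\<lambda>n. \<Prod>j\<in>UNIV. ?f j (n j)) has_sum exp ?s) UNIV"
    using has_sum_infsum[OF a] b unfolding P b' by simp
  have "((\<lambda>n. (cmod (coherent_state \<beta> n))\<^sup>2) has_sum exp (- ?s) * exp ?s) UNIV"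
    unfolding c by (rule has_sum_cmult_right[OF h])
  then have "((\<lambda>n. (cmod (coherent_state \<beta> n))\<^sup>2) has_sum 1) UNIV"
    by (simp flip: exp_add)
  then show ?thesis
    unfolding unit_vector_def fock_space_def fock_norm_def
    by (simp add: infsumI has_sum_imp_summable)
qed

definition is_vacuum :: "'d fock \<Rightarrow> bool" where
  "is_vacuum \<psi> \<longleftrightarrow> (\<exists>c. \<forall>n. \<psi> n = c * vacuum n)"

definition remove_vacuum :: "'d fock \<Rightarrow> 'd fock" where
  "remove_vacuum \<psi> n = \<psi> n - fock_inner vacuum \<psi> * vacuum n"

text \<open>The vector \<open>\<psi>\<close> with a tilde; only meaningful if \<open>\<not> is_vacuum \<psi>\<close>.\<close>

definition tilde :: "'d fock \<Rightarrow> 'd fock" where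
  "tilde \<psi> n = remove_vacuum \<psi> n / complex_of_real (fock_norm (remove_vacuum \<psi>))"

text \<open>
  Outcomes of the detection: \<open>Some k\<close> is a click registered in mode \<open>k\<close>, \<open>None\<close> is no-click.
  A detection is given by the outcome distributions \<open>p n\<close> for every photon number \<open>n\<close>.
\<close>

definition mode_resolved_detection :: "(('d::finite \<Rightarrow> nat) \<Rightarrow> 'd option pmf) \<Rightarrow> bool" where
  "mode_resolved_detection p \<longleftrightarrow>
     (\<forall>n k. n k = 0 \<longrightarrow> pmf (p n) (Some k) = 0) \<and>
     (\<forall>n. n \<noteq> (\<lambda>_. 0) \<longrightarrow> (\<Sum>k\<in>UNIV. pmf (p n) (Some k)) > 0)"

definition detection_operator ::
    "(('d \<Rightarrow> nat) \<Rightarrow> 'd option pmf) \<Rightarrow> 'd option \<Rightarrow> 'd fock \<Rightarrow> 'd fock" where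
  "detection_operator p r \<psi> n = complex_of_real (pmf (p n) r) * \<psi> n"

text \<open>
  \<open>'q\<close> is the type of preparations and \<open>'l\<close> the type of ontic states. The field \<open>prep\<close> is
  \<open>P(\<lambda>|Q)\<close> and the field \<open>resp\<close> is \<open>P(r|M,\<lambda>)\<close>.
\<close>

record ('q, 'l, 'd) model =
  state :: "'q \<Rightarrow> 'd fock"
  prep :: "'q \<Rightarrow> 'l pmf"
  resp :: "'l \<Rightarrow> 'd option pmf"

definition ontic_model :: "('q, 'l, 'd::finite) model \<Rightarrow> bool" where
  "ontic_model m \<longleftrightarrow>
     (\<forall>Q. unit_vector (state m Q)) \<and> (\<forall>\<beta>. \<exists>Q. state m Q = coherent_state \<beta>)"

definition predicted :: "('q, 'l, 'd::finite) model \<Rightarrow> 'q \<Rightarrow> 'd option \<Rightarrow> real" where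
  "predicted m Q r = (\<Sum>\<^sub>\<infinity>l. pmf (resp m l) r * pmf (prep m Q) l)"

definition clk_ontic :: "('q, 'l, 'd::finite) model \<Rightarrow> 'l \<Rightarrow> real" where
  "clk_ontic m l = (\<Sum>k\<in>UNIV. pmf (resp m l) (Some k))"

definition clk_prep :: "('q, 'l, 'd::finite) model \<Rightarrow> 'q \<Rightarrow> real" where
  "clk_prep m Q = (\<Sum>\<^sub>\<infinity>l. clk_ontic m l * pmf (prep m Q) l)"

text \<open>\<open>P(\<lambda>|Q,clk)\<close>; only meaningful if \<open>clk_prep m Q > 0\<close>.\<close>

definition prep_given_clk :: "('q, 'l, 'd::finite) model \<Rightarrow> 'q \<Rightarrow> 'l \<Rightarrow> real" where
  "prep_given_clk m Q l = clk_ontic m l * pmf (prep m Q) l / clk_prep m Q"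

definition psi_epistemic :: "('q, 'l, 'd::finite) model \<Rightarrow> bool" where
  "psi_epistemic m \<longleftrightarrow>
     (\<exists>Q Q'. state m Q \<noteq> state m Q' \<and> (\<exists>l. pmf (prep m Q) l > 0 \<and> pmf (prep m Q') l > 0))"

definition delta_continuous :: "real \<Rightarrow> ('q, 'l, 'd::finite) model \<Rightarrow> bool" where
  "delta_continuous \<delta> m \<longleftrightarrow>
     (\<forall>Q. \<not> is_vacuum (state m Q) \<and> clk_prep m Q > 0 \<longrightarrow>
        (\<exists>l. \<forall>Q'. \<not> is_vacuum (state m Q') \<and>
                cmod (fock_inner (tilde (state m Q')) (tilde (state m Q))) \<ge> 1 - \<delta> \<longrightarrow>
              clk_prep m Q' > 0 \<and> prep_given_clk m Q' l > 0))"

definition reproduces_coherent_statistics ::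
    "(('d::finite \<Rightarrow> nat) \<Rightarrow> 'd option pmf) \<Rightarrow> ('q, 'l, 'd) model \<Rightarrow> bool" where
  "reproduces_coherent_statistics p m \<longleftrightarrow>
     (\<forall>Q r. (\<exists>\<beta>. state m Q = coherent_state \<beta>) \<longrightarrow>
        complex_of_real (predicted m Q r) =
          fock_inner (state m Q) (detection_operator p r (state m Q)))"

end

theory Submission
  imports Defs "HOL-Real_Asymp.Real_Asymp"
begin

text \<open>
  Compare the coherent state with all amplitudes equal to \<open>sqrt x\<close> with the \<open>d\<close> coherent states
  obtained from it by setting the amplitude of one mode \<open>k\<close> to zero. Without their vacuum
  components, the overlap tends to \<open>sqrt ((d - 1) / d)\<close> as \<open>x\<close> tends to 0, so for small \<open>x\<close>
  continuity gives one ontic state that clicks with positive probability and is compatible with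
  all the \<open>d\<close> modified states. But the modified state with no photon in mode \<open>k\<close> never triggers
  a click in mode \<open>k\<close>, so this ontic state cannot click in any mode.
\<close>

section \<open>Removing the vacuum component of a Fock vector\<close>

lemma fock_inner_vacuum: "fock_inner vacuum \<psi> = \<psi> (\<lambda>_. 0)"
proof -
  have "fock_inner vacuum \<psi> = (\<Sum>\<^sub>\<infinity>n\<in>{\<lambda>_. 0}. cnj (vacuum n) * \<psi> n)"
    unfolding fock_inner_def by (rule infsum_cong_neutral) (auto simp: vacuum_def)
  then show ?thesis by (simp add: vacuum_def)
qed

lemma remove_vacuum_apply: "remove_vacuum \<psi> n = (if n = (\<lambda>_. 0) then 0 else \<psi> n)"
  by (simp add: remove_vacuum_def fock_inner_vacuum vacuum_def)

lemma has_sum_remove_vacuum: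
  assumes "unit_vector \<psi>"
  shows "((\<lambda>n. (cmod (remove_vacuum \<psi> n))\<^sup>2) has_sum (1 - (cmod (\<psi> (\<lambda>_. 0)))\<^sup>2)) UNIV"
proof -
  let ?z = "(\<lambda>_. 0) :: 'a \<Rightarrow> nat"
  have "((\<lambda>n. (cmod (\<psi> n))\<^sup>2) has_sum 1) UNIV"
    using assms has_sum_infsum
    by (fastforce simp: unit_vector_def fock_space_def fock_norm_def)
  moreover have "((\<lambda>n. (cmod (\<psi> n))\<^sup>2) has_sum (cmod (\<psi> ?z))\<^sup>2) {?z}"
    by (simp add: has_sum_finite_iff)
  ultimately have "((\<lambda>n. (cmod (\<psi> n))\<^sup>2) has_sum (1 - (cmod (\<psi> ?z))\<^sup>2)) (UNIV - {?z})"
    by (rule has_sum_Diff) simp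
  then show ?thesis
    by (rule has_sum_cong_neutral[THEN iffD1, rotated -1]) (auto simp: remove_vacuum_apply)
qed

lemma fock_norm_remove_vacuum:
  "unit_vector \<psi> \<Longrightarrow> fock_norm (remove_vacuum \<psi>) = sqrt (1 - (cmod (\<psi> (\<lambda>_. 0)))\<^sup>2)"
  by (simp add: fock_norm_def infsumI[OF has_sum_remove_vacuum])

lemma cnj_mult_self: "cnj z * z = (complex_of_real (cmod z))\<^sup>2"
  by (metis complex_norm_square mult.commute of_real_power)

text \<open>On the support of \<open>\<phi>\<close> the coefficients of \<open>\<psi>\<close> are
  those of \<open>\<phi>\<close> divided by \<open>c\<close>. So without vacuum components the inner
  product is the squared norm of \<open>\<phi>\<close> over \<open>c\<close>, and normalising both
  vectors leaves a quotient of norms.\<close>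

lemma fock_inner_tilde_restriction:
  assumes "unit_vector \<phi>" "fock_norm (remove_vacuum \<phi>) > 0"
    and \<phi>: "\<And>n. \<phi> n = (if P n then complex_of_real c * \<psi> n else 0)" and "c > 0"
  shows "fock_inner (tilde \<phi>) (tilde \<psi>) =
    complex_of_real (fock_norm (remove_vacuum \<phi>) / (c * fock_norm (remove_vacuum \<psi>)))"
proof -
  define a b where "a = fock_norm (remove_vacuum \<phi>)" and "b = fock_norm (remove_vacuum \<psi>)"
  have sum: "((\<lambda>n. (cmod (remove_vacuum \<phi> n))\<^sup>2) has_sum a\<^sup>2) UNIV"
    using has_sum_remove_vacuum[OF assms(1)] assms(2) fock_norm_remove_vacuum[OF assms(1)]
    by (simp add: a_def)
  have "cnj (tilde \<phi> n) * tilde \<psi> n =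
      complex_of_real ((cmod (remove_vacuum \<phi> n))\<^sup>2 * (1 / (c * a * b)))" for n
  proof -
    have "cnj (remove_vacuum \<phi> n) * remove_vacuum \<psi> n =
        complex_of_real ((cmod (remove_vacuum \<phi> n))\<^sup>2 / c)"
      using \<open>c > 0\<close> cnj_mult_self[of "\<psi> n"]
      by (simp add: remove_vacuum_apply \<phi> norm_mult power_mult_distrib mult.assoc)
        (simp add: power2_eq_square)
    then show ?thesis
      by (simp add: tilde_def field_simps flip: a_def b_def)
  qed
  then have "fock_inner (tilde \<phi>) (tilde \<psi>) = complex_of_real (a\<^sup>2 * (1 / (c * a * b)))"
    unfolding fock_inner_def
    by (simp only: infsumI[OF has_sum_of_real[OF has_sum_cmult_left[OF sum]]])
  also have "a\<^sup>2 * (1 / (c * a * b)) = a / (c * b)"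
    using assms(2) by (simp add: power2_eq_square flip: a_def)
  finally show ?thesis by (simp add: a_def b_def)
qed

section \<open>Coherent states with one mode switched off, and their overlaps\<close>

lemma coherent_state_nonzero_iff:
  "coherent_state \<beta> n \<noteq> 0 \<longleftrightarrow> (\<forall>j. \<beta> j = 0 \<longrightarrow> n j = 0)"
  by (auto simp: coherent_state_coefficient)

lemma cmod_coherent_state_vacuum:
  "(cmod (coherent_state \<beta> (\<lambda>_. 0)))\<^sup>2 = exp (- (\<Sum>j\<in>UNIV. (cmod (\<beta> j))\<^sup>2))"
  by (simp add: coherent_state_coefficient power2_eq_square norm_mult flip: exp_add)

lemma not_is_vacuum_coherent_state:
  assumes "\<beta> j \<noteq> 0"
  shows "\<not> is_vacuum (coherent_state \<beta>)"
proof
  \<comment> \<open>A single photon in mode \<open>j\<close> has nonzero amplitude here but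
    amplitude 0 in any multiple of the vacuum.\<close>
  let ?n = "(\<lambda>_. 0)(j := Suc 0)"
  assume "is_vacuum (coherent_state \<beta>)"
  then have "coherent_state \<beta> ?n = 0"
    by (auto simp: is_vacuum_def vacuum_def fun_eq_iff)
  then show False
    using coherent_state_nonzero_iff[of \<beta> ?n] assms by (auto split: if_splits)
qed

text \<open>The factor of mode \<open>k\<close> contains \<open>0 ^ n k\<close>, which is 1 for
  \<open>n k = 0\<close> and 0 otherwise. The exponential compensates for the loss of mode
  \<open>k\<close> in the normalising Gaussian. This is the form that
  \<open>fock_inner_tilde_restriction\<close> takes as a premise.\<close>

lemma coherent_state_switch_off:
  "coherent_state (\<beta>(k := 0)) n =
     (if n k = 0 then complex_of_real (exp ((cmod (\<beta> k))\<^sup>2 / 2)) * coherent_state \<beta> n else 0)"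
proof (cases "n k = 0")
  case True
  have s: "(\<Sum>j\<in>UNIV. (cmod (\<beta> j))\<^sup>2) =
      (cmod (\<beta> k))\<^sup>2 + (\<Sum>j\<in>UNIV. (cmod ((\<beta>(k := 0)) j))\<^sup>2)"
    by (simp add: sum.remove[of UNIV k])
  have e: "exp (- (1/2) * (\<Sum>j\<in>UNIV. (cmod ((\<beta>(k := 0)) j))\<^sup>2)) =
      exp ((cmod (\<beta> k))\<^sup>2 / 2) * exp (- (1/2) * (\<Sum>j\<in>UNIV. (cmod (\<beta> j))\<^sup>2))"
    unfolding s by (simp add: algebra_simps add_divide_distrib flip: exp_add)
  have pr: "(\<Prod>j\<in>UNIV. (\<beta>(k := 0)) j ^ n j / complex_of_real (sqrt (fact (n j)))) =
      (\<Prod>j\<in>UNIV. \<beta> j ^ n j / complex_of_real (sqrt (fact (n j))))"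
    using True by (intro prod.cong) auto
  show ?thesis
    unfolding coherent_state_coefficient e pr using True by simp
next
  case False
  then show ?thesis
    using coherent_state_nonzero_iff[of "\<beta>(k := 0)" n] by auto
qed

lemma overlap_switch_off:
  fixes k :: "'d::finite" and x :: real
  defines "\<beta> \<equiv> (\<lambda>_ :: 'd. complex_of_real (sqrt x))" and "D \<equiv> real CARD('d)"
  assumes "x > 0" "CARD('d) \<ge> 2"
  shows "cmod (fock_inner (tilde (coherent_state (\<beta>(k := 0)))) (tilde (coherent_state \<beta>))) =
    sqrt ((exp (- x) - exp (- D * x)) / (1 - exp (- D * x)))"
proof -
  let ?\<phi> = "coherent_state (\<beta>(k := 0))" and ?\<psi> = "coherent_state \<beta>"
  have sq_norm: "(cmod (\<beta> j))\<^sup>2 = x" for j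
    using \<open>x > 0\<close> by (simp add: \<beta>_def)
  have s: "(\<Sum>j\<in>UNIV. (cmod (\<beta> j))\<^sup>2) = D * x"
    by (simp add: sq_norm D_def)
  have "(\<Sum>j\<in>UNIV. (cmod ((\<beta>(k := 0)) j))\<^sup>2) = (\<Sum>j\<in>UNIV - {k}. (cmod (\<beta> j))\<^sup>2)"
    by (simp add: sum.remove[of UNIV k])
  then have sk: "(\<Sum>j\<in>UNIV. (cmod ((\<beta>(k := 0)) j))\<^sup>2) = (D - 1) * x"
    using assms(4) by (simp add: sq_norm D_def of_nat_diff)
  have N: "fock_norm (remove_vacuum ?\<psi>) = sqrt (1 - exp (- D * x))"
    by (simp add: fock_norm_remove_vacuum unit_vector_coherent_state cmod_coherent_state_vacuum s)
  have Nk: "fock_norm (remove_vacuum ?\<phi>) = sqrt (1 - exp (- ((D - 1) * x)))"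
    by (simp only: fock_norm_remove_vacuum unit_vector_coherent_state cmod_coherent_state_vacuum sk)
  have pos: "(D - 1) * x > 0"
    using assms(3,4) by (simp add: D_def)
  then have Nk_pos: "fock_norm (remove_vacuum ?\<phi>) > 0"
    unfolding Nk by simp
  have ex: "exp (x / 2) = sqrt (exp x)"
    by (rule real_sqrt_unique[symmetric]) (simp_all add: power2_eq_square flip: exp_add)
  have "fock_inner (tilde ?\<phi>) (tilde ?\<psi>) =
      complex_of_real (sqrt (1 - exp (- ((D - 1) * x))) / (exp (x / 2) * sqrt (1 - exp (- D * x))))"
    using fock_inner_tilde_restriction[OF unit_vector_coherent_state Nk_pos
        coherent_state_switch_off exp_gt_zero]
    unfolding N Nk sq_norm .
  also have "sqrt (1 - exp (- ((D - 1) * x))) / (exp (x / 2) * sqrt (1 - exp (- D * x))) =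
      sqrt ((1 - exp (- ((D - 1) * x))) / exp x / (1 - exp (- D * x)))"
    by (simp add: ex real_sqrt_divide real_sqrt_mult)
  also have "(1 - exp (- ((D - 1) * x))) / exp x = exp (- x) - exp (- D * x)"
    by (simp add: diff_divide_distrib divide_inverse algebra_simps flip: exp_minus exp_add)
  finally have overlap: "fock_inner (tilde ?\<phi>) (tilde ?\<psi>) =
    complex_of_real (sqrt ((exp (- x) - exp (- D * x)) / (1 - exp (- D * x))))" .
  have "x \<le> D * x"
    using pos by (simp add: algebra_simps)
  then have "0 \<le> sqrt ((exp (- x) - exp (- D * x)) / (1 - exp (- D * x)))"
    using \<open>x > 0\<close> by simp
  then show ?thesis
    unfolding overlap by (simp only: norm_of_real abs_of_nonneg)
qed

text \<open>To first order in \<open>x\<close> the numerator is \<open>(D - 1) * x\<close> and the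
  denominator \<open>D * x\<close>.\<close>

lemma overlap_limit:
  fixes D :: real
  assumes "D > 1"
  shows "((\<lambda>x. sqrt ((exp (- x) - exp (- D * x)) / (1 - exp (- D * x)))) \<longlongrightarrow>
    sqrt ((D - 1) / D)) (at_right 0)"
proof (rule tendsto_real_sqrt)
  show "((\<lambda>x. (exp (- x) - exp (- D * x)) / (1 - exp (- D * x))) \<longlongrightarrow> (D - 1) / D) (at_right 0)"
    using assms by (real_asymp simp: field_simps)
qed

section \<open>Vanishing and positive probabilities in the ontic model\<close>

lemma pmf_summable_on: "pmf q summable_on A"
  using pmf_abs_summable[of q A] abs_summable_equivalent[of "pmf q" A]
  by (simp add: Infinite_Sum.abs_summable_summable)

text \<open>\<open>infsum\<close> is 0 on families that are not summable, so summability is what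
  lets a vanishing prediction force each of its terms to vanish.\<close>

lemma summable_on_pmf_mult:
  fixes f :: "'a \<Rightarrow> real"
  assumes "\<And>x. 0 \<le> f x" "\<And>x. f x \<le> C"
  shows "(\<lambda>x. f x * pmf q x) summable_on UNIV"
  by (rule summable_on_comparison_test[OF summable_on_cmult_right[OF pmf_summable_on]])
    (auto intro: mult_right_mono assms mult_nonneg_nonneg)

lemma clk_ontic_nonneg: "0 \<le> clk_ontic m l"
  by (simp add: clk_ontic_def sum_nonneg)

lemma clk_ontic_le: "clk_ontic (m :: ('q, 'l, 'd::finite) model) l \<le> real CARD('d)"
  unfolding clk_ontic_def
  using sum_bounded_above[of UNIV "\<lambda>k :: 'd. pmf (resp m l) (Some k)" 1] by (simp add: pmf_le_1)

lemma predicted_eq_0_D: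
  assumes "predicted m Q r = 0"
  shows "pmf (resp m l) r * pmf (prep m Q) l = 0"
  using assms
  by (intro nonneg_infsum_le_0D[OF _ summable_on_pmf_mult[of "\<lambda>l. pmf (resp m l) r" 1]])
    (auto simp: predicted_def pmf_le_1)

text \<open>Without clicks overall, no ontic state in the support of \<open>prep m Q\<close> clicks,
  so none of them gives outcome \<open>Some k\<close>.\<close>

lemma clk_prep_pos:
  assumes "predicted m Q (Some k) \<noteq> 0"
  shows "clk_prep m Q > 0"
proof (rule ccontr)
  assume "\<not> clk_prep m Q > 0"
  then have z: "clk_ontic m l * pmf (prep m Q) l = 0" for l
    by (intro nonneg_infsum_le_0D[OF _ summable_on_pmf_mult[OF clk_ontic_nonneg clk_ontic_le]])
      (auto simp: clk_prep_def clk_ontic_nonneg)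
  have "pmf (resp m l) (Some k) \<le> clk_ontic m l" for l
    unfolding clk_ontic_def by (rule member_le_sum) auto
  then have "pmf (resp m l) (Some k) * pmf (prep m Q) l = 0" for l
    using z[of l] pmf_nonneg[of "resp m l" "Some k"] by (metis mult_eq_0_iff order_antisym)
  then show False
    using assms by (simp only: predicted_def infsum_0 not_True_eq_False)
qed

section \<open>Quantum predictions for coherent states\<close>

lemma summable_on_detection:
  assumes "\<psi> \<in> fock_space"
  shows "(\<lambda>n. pmf (p n) r * (cmod (\<psi> n))\<^sup>2) summable_on UNIV"
  using assms unfolding fock_space_def mem_Collect_eq
  by (rule summable_on_comparison_test) (auto intro: mult_left_le_one_le simp: pmf_le_1)

lemma fock_inner_detection_operator:
  assumes "\<psi> \<in> fock_space"
  shows "fock_inner \<psi> (detection_operator p r \<psi>) =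
    complex_of_real (\<Sum>\<^sub>\<infinity>n. pmf (p n) r * (cmod (\<psi> n))\<^sup>2)"
proof -
  have "cnj (\<psi> n) * detection_operator p r \<psi> n =
      complex_of_real (pmf (p n) r * (cmod (\<psi> n))\<^sup>2)" for n
    using cnj_mult_self[of "\<psi> n"] by (simp add: detection_operator_def mult.left_commute)
  then show ?thesis
    unfolding fock_inner_def
    by (simp only: infsumI[OF has_sum_of_real[OF has_sum_infsum[OF summable_on_detection[OF assms]]]])
qed

lemma coherent_state_in_fock_space: "coherent_state \<beta> \<in> fock_space"
  using unit_vector_coherent_state by (auto simp: unit_vector_def)

lemma predicted_coherent_state:
  assumes "reproduces_coherent_statistics p m" "state m Q = coherent_state \<beta>"
  shows "predicted m Q r = (\<Sum>\<^sub>\<infinity>n. pmf (p n) r * (cmod (coherent_state \<beta> n))\<^sup>2)"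
proof -
  have "complex_of_real (predicted m Q r) =
      fock_inner (state m Q) (detection_operator p r (state m Q))"
    using assms unfolding reproduces_coherent_statistics_def by blast
  then show ?thesis
    unfolding assms(2) fock_inner_detection_operator[OF coherent_state_in_fock_space] of_real_eq_iff .
qed

text \<open>Every number state in the support of this coherent state has no photon in mode
  \<open>k\<close>, and such states never give a click there.\<close>

lemma predicted_dark_mode:
  assumes "mode_resolved_detection p" "reproduces_coherent_statistics p m"
    and "state m Q = coherent_state \<beta>" "\<beta> k = 0"
  shows "predicted m Q (Some k) = 0"
proof -
  have "pmf (p n) (Some k) * (cmod (coherent_state \<beta> n))\<^sup>2 = 0" for n
    using assms(1,4) coherent_state_nonzero_iff[of \<beta> n]
    by (auto simp: mode_resolved_detection_def)
  then show ?thesis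
    unfolding predicted_coherent_state[OF assms(2,3)] by (rule infsum_0)
qed

text \<open>The number state with one photon, in mode \<open>j\<close>, has positive weight and
  clicks with positive probability, so some click outcome has a positive prediction.\<close>

lemma clk_prep_coherent_state_pos:
  assumes "mode_resolved_detection p" "reproduces_coherent_statistics p m"
    and "state m Q = coherent_state \<beta>" "\<beta> j \<noteq> 0"
  shows "clk_prep m Q > 0"
proof -
  let ?n = "(\<lambda>_. 0)(j := Suc 0)"
  have "(\<Sum>k\<in>UNIV. pmf (p ?n) (Some k)) > 0"
    using assms(1) by (auto simp: mode_resolved_detection_def fun_eq_iff)
  then obtain k where k: "pmf (p ?n) (Some k) \<noteq> 0"
    by (metis less_irrefl sum.neutral)
  have nz: "coherent_state \<beta> ?n \<noteq> 0"
    using assms(4) by (auto simp: coherent_state_nonzero_iff)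
  have "predicted m Q (Some k) \<noteq> 0"
    using summable_on_detection[OF coherent_state_in_fock_space, of p "Some k" \<beta>]
      nonneg_infsum_le_0D[of "\<lambda>n. pmf (p n) (Some k) * (cmod (coherent_state \<beta> n))\<^sup>2" UNIV ?n]
      k nz by (auto simp: predicted_coherent_state[OF assms(2,3)])
  then show ?thesis by (rule clk_prep_pos)
qed

section \<open>Contradiction from an ontic state shared by all switched-off preparations\<close>

theorem theorem2:
  fixes \<delta>\<^sub>0 :: real
    and p :: "('d::finite \<Rightarrow> nat) \<Rightarrow> 'd option pmf"
  assumes "CARD('d) \<ge> 2"
    and "\<delta>\<^sub>0 > 1 - sqrt ((real CARD('d) - 1) / real CARD('d))"
    and "mode_resolved_detection p"
  shows "\<not> (\<exists>m :: ('q, 'l, 'd) model.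
           ontic_model m \<and> psi_epistemic m \<and> delta_continuous \<delta>\<^sub>0 m \<and>
           reproduces_coherent_statistics p m)"
proof (rule notI, elim exE conjE)
  fix m :: "('q, 'l, 'd) model"
  assume om: "ontic_model m" and dc: "delta_continuous \<delta>\<^sub>0 m"
    and rep: "reproduces_coherent_statistics p m"
  define D where "D = real CARD('d)"
  have "D > 1" using assms(1) by (simp add: D_def)
  \<comment> \<open>The bound on \<open>\<delta>\<^sub>0\<close> is strict, so
    \<open>1 - \<delta>\<^sub>0\<close> lies below the limit of the overlap and hence below the
    overlap itself for small \<open>x\<close>.\<close>
  have "\<forall>\<^sub>F x in at_right 0. x > 0 \<and>
      1 - \<delta>\<^sub>0 < sqrt ((exp (- x) - exp (- D * x)) / (1 - exp (- D * x)))"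
    using assms(2)
    by (intro eventually_conj eventually_at_right_less order_tendstoD(1)[OF overlap_limit[OF \<open>D > 1\<close>]])
      (simp add: D_def)
  then obtain x :: real where "x > 0"
    and x: "1 - \<delta>\<^sub>0 < sqrt ((exp (- x) - exp (- D * x)) / (1 - exp (- D * x)))"
    using eventually_happens'[OF trivial_limit_at_right_real] by blast
  define \<beta> where "\<beta> = (\<lambda>_ :: 'd. complex_of_real (sqrt x))"
  have \<beta>: "\<beta> j \<noteq> 0" for j using \<open>x > 0\<close> by (simp add: \<beta>_def)
  obtain Q where Q: "state m Q = coherent_state \<beta>"
    using om by (auto simp: ontic_model_def)
  have "\<forall>k. \<exists>Q'. state m Q' = coherent_state (\<beta>(k := 0))"
    using om by (auto simp: ontic_model_def)
  then obtain R where R: "state m (R k) = coherent_state (\<beta>(k := 0))" for k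
    by metis
  have nv: "\<not> is_vacuum (state m (R k))" for k
  proof -
    \<comment> \<open>With at least two modes, another one stays bright when mode \<open>k\<close>
      is switched off.\<close>
    obtain j where "j \<noteq> k"
      using assms(1) card_mono[of "{k}" UNIV] by force
    then show ?thesis
      unfolding R using \<beta>[of j] by (intro not_is_vacuum_coherent_state[of _ j]) simp
  qed
  have "\<not> is_vacuum (state m Q)" "clk_prep m Q > 0"
    using clk_prep_coherent_state_pos[OF assms(3) rep Q \<beta>] not_is_vacuum_coherent_state[of \<beta>] \<beta>
    by (auto simp: Q)
  \<comment> \<open>Continuity is applied at \<open>Q\<close> only: \<open>l\<close> is fixed before
    any mode \<open>k\<close> is chosen, so the same \<open>l\<close> serves every
    \<open>R k\<close>.\<close>
  then obtain l where l: "\<And>Q'. \<not> is_vacuum (state m Q') \<Longrightarrow>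
      cmod (fock_inner (tilde (state m Q')) (tilde (state m Q))) \<ge> 1 - \<delta>\<^sub>0 \<Longrightarrow>
      prep_given_clk m Q' l > 0"
    using dc unfolding delta_continuous_def by blast
  have overlap: "cmod (fock_inner (tilde (state m (R k))) (tilde (state m Q))) \<ge> 1 - \<delta>\<^sub>0" for k
    unfolding R Q \<beta>_def overlap_switch_off[OF \<open>x > 0\<close> assms(1)]
    using x unfolding D_def by (rule less_imp_le)
  have pos: "prep_given_clk m (R k) l > 0" for k
    by (rule l[OF nv overlap])
  have "pmf (resp m l) (Some k) = 0" for k
  proof -
    \<comment> \<open>Mode \<open>k\<close> is dark in \<open>R k\<close>, and \<open>pos\<close>
      puts \<open>l\<close> in the support of that preparation, so only the response factor can
      vanish.\<close>
    have "pmf (resp m l) (Some k) * pmf (prep m (R k)) l = 0"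
      by (rule predicted_eq_0_D[OF predicted_dark_mode[OF assms(3) rep R]]) simp
    then show ?thesis
      using pos[of k] by (auto simp: prep_given_clk_def)
  qed
  \<comment> \<open>All summands of \<open>clk_ontic m l\<close> are now 0, whereas
    \<open>pos\<close> makes it nonzero.\<close>
  then show False
    using pos by (simp add: prep_given_clk_def clk_ontic_def)
qed

end
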